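(* Let $a\in\mathbb{R}\setminus\{0\}$ and let $p\ge1$ be an integer. A numerical time integration of order $2p$ applied to the transport equation $\partial_t u+a\,\partial_x u=0$ is, at worst, stable under the CFL-like condition $$\delta t\le C\Big(\frac{\delta x}{|a|}\Big)^{\frac{2p+2}{2p+1}}.$$ That is: for every $K>0$ there exist a constant $C>0$ (depending only on the scheme and on $K$) and $h>0$ such that, for all $\delta x\in(0,h)$ and all $\delta t>0$ satisfying $\delta t\le C\big(\frac{\delta x}{|a|}\big)^{\frac{2p+2}{2p+1}}$, the amplification factor $g$ of the scheme satisfies $$|g(-ia\xi\,\delta t)|\le 1+K\,\delta t\qquad\text{for all }\xi\in\Big[-\tfrac1{\delta x},\tfrac1{\delta x}\Big].$$
   Context: For an explicit time scheme with real coefficients (Runge-Kutta, multistep, or mixed) with time step $\delta t$, applied to $\partial_t u=Fu$ with $F$ linear with Fourier symbol $\sigma(\xi)$ (here $\sigma(\xi)=-ia\xi$), a Fourier mode $e^{i\xi x}$ is advanced by $X_{n+1}=M(\zeta)X_n$ with $\zeta=\sigma(\xi)\delta t$, where $X_n=(u_n,\dots,u_{n-s})^{T}$ collects the time levels used and $M(\zeta)$ is a square matrix with entries real polynomials in $\zeta$. The amplification factor $g(\zeta)$ is the eigenvalue of $M(\zeta)$ of largest modulus near $\zeta=0$; it is holomorphic near $0$ with real Taylor coefficients. (For a Runge-Kutta scheme $M=g$ is a scalar polynomial.) The scheme has order $2p$ if $u_{n+1}=u_n+\delta t\,\partial_tu_n+\frac{\delta t^2}{2}\partial_t^2u_n+\dots+\frac{\delta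 t^{2p}}{(2p)!}\partial_t^{2p}u_n+o(\delta t^{2p})$; since $\partial_t^\ell u=F^\ell u$ for the transport equation, this means $g(\zeta)=\sum_{\ell=0}^{2p}\frac{\zeta^\ell}{\ell!}+o(\zeta^{2p})$ as $\zeta\to0$. Stability is in the von Neumann sense: growth per time step at most $1+K\delta t$ with $K$ independent of $\delta t,\delta x$, over the resolved frequencies $|\xi|\le1/\delta x$ ($\delta x$ is the space step; a factor $\pi$ is discarded). *)

theory Defs
  imports
    "HOL-Complex_Analysis.Complex_Analysis"
    "HOL-Library.Landau_Symbols"
    "Jordan_Normal_Form.Char_Poly"
begin

text \<open>
  An explicit scheme with real coefficients acts on a Fourier mode by \<open>X\<^sub>n\<^sub>+\<^sub>1 = M(\<zeta>) X\<^sub>n\<close>,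
  where \<open>X\<^sub>n = (u\<^sub>n, \<dots>, u\<^sub>n\<^sub>-\<^sub>s)\<close> and \<open>\<zeta>\<close> is the Fourier symbol times the time step.  It is
  represented by the matrix \<open>M\<close> of real polynomials; a Runge-Kutta scheme is the case of a
  1 by 1 matrix.
\<close>

definition scheme_matrix_at :: "real poly mat \<Rightarrow> complex \<Rightarrow> complex mat" where
  "scheme_matrix_at M \<zeta> = map_mat (\<lambda>q. poly (map_poly complex_of_real q) \<zeta>) M"

text \<open>
  The eigenvalue branch has to be of largest modulus only at purely imaginary \<open>\<zeta>\<close>, which are the
  values taken by the symbol of the transport equation times the time step.  Requiring this on a
  full complex neighbourhood would exclude schemes such as leapfrog: there the eigenvalues
  \<open>\<zeta> \<plusminus> sqrt (1 + \<zeta>\<^sup>2)\<close> have equal modulus on the imaginary axis near 0, but the parasitic one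
  is the larger for \<open>Re \<zeta> < 0\<close>.
\<close>

definition amplification_factor :: "real poly mat \<Rightarrow> (complex \<Rightarrow> complex) \<Rightarrow> bool" where
  "amplification_factor M g \<longleftrightarrow>
     g analytic_on {0} \<and>
     (\<forall>n. (deriv ^^ n) g 0 \<in> \<real>) \<and>
     (\<forall>\<^sub>F \<zeta> in nhds 0. eigenvalue (scheme_matrix_at M \<zeta>) (g \<zeta>)) \<and>
     (\<forall>\<^sub>F y in nhds (0::real). \<forall>l. eigenvalue (scheme_matrix_at M (\<i> * of_real y)) l \<longrightarrow>
        norm l \<le> norm (g (\<i> * of_real y)))"

definition has_order :: "(complex \<Rightarrow> complex) \<Rightarrow> nat \<Rightarrow> bool" where
  "has_order g m \<longleftrightarrow> (\<lambda>\<zeta>. g \<zeta> - (\<Sum>l\<le>m. \<zeta> ^ l / fact l)) \<in> o[at 0](\<lambda>\<zeta>. \<zeta> ^ m)"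

end

theory Submission imports Defs begin

text \<open>
  Since \<open>g\<close> has real Taylor coefficients and agrees with \<open>exp\<close> up to order \<open>2p\<close>, on the imaginary
  axis it is \<open>exp (\<i>y) + \<i>ey\<^sup>2\<^sup>p\<^sup>+\<^sup>1 + O(y\<^sup>2\<^sup>p\<^sup>+\<^sup>2)\<close> with \<open>e\<close> real.  The term of odd order is orthogonal to
  \<open>exp 0 = 1\<close>, so it changes the modulus only at order \<open>2p + 2\<close>, and \<open>|g(\<i>y)| \<le> 1 + By\<^sup>2\<^sup>p\<^sup>+\<^sup>2\<close>.
  The CFL condition makes \<open>y = a\<xi>\<delta>t\<close> small and \<open>y\<^sup>2\<^sup>p\<^sup>+\<^sup>2 \<le> C\<^sup>2\<^sup>p\<^sup>+\<^sup>1\<delta>t\<close>.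
\<close>

text \<open>Near 0 a function with nonzero expansion is asymptotic to its leading term, and here the
  leading exponent is at least \<open>n\<close>.\<close>

lemma has_fps_expansion_imp_bigo:
  fixes f :: "complex \<Rightarrow> complex"
  assumes F: "f has_fps_expansion F" and "\<And>k. k < n \<Longrightarrow> fps_nth F k = 0"
  shows "f \<in> O[nhds 0](\<lambda>z. z ^ n)"
proof (cases "F = 0")
  \<comment> \<open>The zero series has \<open>subdegree\<close> 0 by convention, so its subdegree
    says nothing about \<open>n\<close>; here \<open>f\<close> itself vanishes near 0.\<close>
  case True
  then have "eventually (\<lambda>z. f z = 0) (nhds 0)"
    using F by (auto simp: has_fps_expansion_def elim: eventually_mono)
  then show ?thesis
    by (simp add: landau_o.big.in_cong)
next
  case False
  define m where "m = subdegree F"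
  have "n \<le> m"
    using assms(2) False unfolding m_def by (meson nth_subdegree_nonzero not_less)
  have "f \<in> O[nhds 0](\<lambda>z. fps_nth F m * z ^ m)"
    unfolding m_def by (intro asymp_equiv_imp_bigo has_fps_expansion_imp_asymp_equiv_0 F)
  also have "(\<lambda>z. fps_nth F m * z ^ m) \<in> O[nhds 0](\<lambda>z. z ^ n)"
  proof -
    have "((\<lambda>z. fps_nth F m * z ^ (m - n)) \<longlongrightarrow> fps_nth F m * 0 ^ (m - n)) (nhds 0)"
      by (intro tendsto_intros filterlim_ident)
    then have "(\<lambda>z. fps_nth F m * z ^ (m - n)) \<in> O[nhds 0](\<lambda>_. 1)"
      by (intro bigoI_tendsto) auto
    then have "(\<lambda>z. fps_nth F m * z ^ (m - n) * z ^ n) \<in> O[nhds 0](\<lambda>z. 1 * z ^ n)"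
      by (intro landau_o.big.mult) auto
    then show ?thesis
      using \<open>n \<le> m\<close> by (simp add: mult.assoc flip: power_add)
  qed
  finally show ?thesis .
qed

text \<open>Turns the little-o in \<open>has_order\<close> into equations between coefficients. A
  nonzero coefficient of index at most \<open>m\<close> would give a leading exponent
  \<open>n \<le> m\<close>, and then \<open>z ^ n\<close> would be O(f), hence o(z^m), hence
  o(z^n).\<close>

lemma has_fps_expansion_smallo_imp_nth_eq_0:
  fixes f :: "complex \<Rightarrow> complex"
  assumes F: "f has_fps_expansion F" and f: "f \<in> o[at 0](\<lambda>z. z ^ m)" and "k \<le> m"
  shows "fps_nth F k = 0"
proof (rule ccontr)
  assume k: "fps_nth F k \<noteq> 0"
  define n where "n = subdegree F"
  have "n \<le> m"
    using subdegree_leI[OF k] \<open>k \<le> m\<close> by (simp add: n_def)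
  have n: "fps_nth F n \<noteq> 0"
    using k by (auto simp: n_def)
  have "f \<sim>[at 0] (\<lambda>z. fps_nth F n * z ^ n)"
    using has_fps_expansion_imp_asymp_equiv_0[OF F] unfolding asymp_equiv_nhds_iff n_def by blast
  then have "(\<lambda>z. fps_nth F n * z ^ n) \<in> O[at 0](f)"
    by (rule asymp_equiv_imp_bigo[OF asymp_equiv_symI])
  then have "(\<lambda>z. z ^ n) \<in> O[at 0](f)"
    using n by simp
  also note f
  also have "(\<lambda>z::complex. z ^ m) \<in> O[at 0](\<lambda>z. z ^ n)"
  proof -
    have "(\<lambda>z::complex. z ^ m) \<in> O[nhds 0](\<lambda>z. z ^ n)"
      using \<open>n \<le> m\<close>
      by (intro has_fps_expansion_imp_bigo[where F = "fps_X ^ m"] fps_expansion_intros) auto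
    then show ?thesis
      by (rule landau_o.big.filter_mono[rotated]) (simp add: at_within_def)
  qed
  \<comment> \<open>A function is little-o of itself only if it is eventually zero, which
    \<open>z ^ n\<close> is not on a punctured neighbourhood.\<close>
  finally have "eventually (\<lambda>z::complex. z ^ n = 0) (at 0)"
    by (simp add: landau_o.small_refl_iff)
  moreover have "eventually (\<lambda>z::complex. z \<noteq> 0) (at 0)"
    by (simp add: eventually_at_filter)
  ultimately have "eventually (\<lambda>z::complex. False) (at 0)"
    by eventually_elim simp
  then show False by simp
qed

text \<open>For odd \<open>n\<close> the added term is purely imaginary, so it only shifts the
  imaginary part \<open>sin y\<close>. The cross term in the squared modulus thus carries a factor
  \<open>sin y\<close>, which supplies the extra power of \<open>y\<close>.\<close>

lemma norm_exp_ii_add_odd_power_le: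
  fixes y e :: real
  assumes y: "\<bar>y\<bar> \<le> 1" and "odd n"
  shows "norm (exp (\<i> * of_real y) + of_real e * (\<i> * of_real y) ^ n)
    \<le> 1 + (\<bar>e\<bar> + e\<^sup>2) * \<bar>y\<bar> ^ Suc n"
proof -
  obtain k where n: "n = Suc (2 * k)"
    using \<open>odd n\<close> by (auto elim: oddE)
  \<comment> \<open>The sign comes from i^n = (-1)^k i, so that the added term is i d y^n.\<close>
  define d where "d = e * (- 1) ^ k"
  have d: "\<bar>d\<bar> = \<bar>e\<bar>" "d\<^sup>2 = e\<^sup>2"
    by (auto simp: d_def abs_mult power_mult_distrib simp flip: power_mult)
  define w where "w = exp (\<i> * of_real y) + of_real e * (\<i> * of_real y) ^ n"
  have w: "w = Complex (cos y) (sin y + d * y ^ n)"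
    by (simp add: w_def n d_def complex_eq_iff exp_Euler power_mult_distrib power_mult
        cos_of_real sin_of_real power_minus[of "y\<^sup>2"] flip: of_real_power of_real_mult)
  have "(norm w)\<^sup>2 = (cos y)\<^sup>2 + (sin y + d * y ^ n)\<^sup>2"
    by (simp add: w cmod_power2)
  also have "\<dots> = ((sin y)\<^sup>2 + (cos y)\<^sup>2) + 2 * (d * y ^ n * sin y) + d\<^sup>2 * (y ^ n)\<^sup>2"
    by (simp add: power2_eq_square algebra_simps)
  also have "\<dots> = 1 + 2 * (d * y ^ n * sin y) + d\<^sup>2 * (y ^ n)\<^sup>2"
    by simp
  also have "d * y ^ n * sin y \<le> \<bar>e\<bar> * \<bar>y\<bar> ^ Suc n"
  proof -
    have "d * y ^ n * sin y \<le> \<bar>d\<bar> * \<bar>y\<bar> ^ n * \<bar>sin y\<bar>"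
      by (metis abs_ge_self abs_mult power_abs)
    also have "\<dots> \<le> \<bar>d\<bar> * \<bar>y\<bar> ^ n * \<bar>y\<bar>"
      by (intro mult_left_mono abs_sin_x_le_abs_x) auto
    finally show ?thesis by (simp add: d mult_ac)
  qed
  \<comment> \<open>The surplus factor 2 brings the sum to the form 1 + 2t, which is at most (1 +
    t)^2. The exponent drops from 2n to n + 1 because |y| \<le> 1 and n \<ge> 1.\<close>
  also have "d\<^sup>2 * (y ^ n)\<^sup>2 \<le> 2 * (e\<^sup>2 * \<bar>y\<bar> ^ Suc n)"
  proof -
    have "(y ^ n)\<^sup>2 = \<bar>y\<bar> ^ (n * 2)"
      by (simp add: power_mult flip: power_abs)
    also have "\<dots> \<le> \<bar>y\<bar> ^ Suc n"
      using y n by (intro power_decreasing) auto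
    finally have "d\<^sup>2 * (y ^ n)\<^sup>2 \<le> e\<^sup>2 * \<bar>y\<bar> ^ Suc n"
      unfolding d by (intro mult_left_mono) auto
    moreover have "0 \<le> e\<^sup>2 * \<bar>y\<bar> ^ Suc n"
      by simp
    ultimately show ?thesis by linarith
  qed
  finally have "(norm w)\<^sup>2 \<le> 1 + 2 * ((\<bar>e\<bar> + e\<^sup>2) * \<bar>y\<bar> ^ Suc n)"
    by (simp add: algebra_simps)
  also have "\<dots> \<le> (1 + (\<bar>e\<bar> + e\<^sup>2) * \<bar>y\<bar> ^ Suc n)\<^sup>2"
    by (simp add: power2_sum)
  finally show ?thesis
    unfolding w_def by (rule power2_le_imp_le) (auto intro!: add_nonneg_nonneg mult_nonneg_nonneg)
qed

lemma norm_imaginary_axis_bound: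
  assumes g: "g analytic_on {0}" and real: "\<And>n. (deriv ^^ n) g 0 \<in> \<real>"
    and order: "has_order g (2 * p)"
  obtains B r where "B > 0" "r > 0"
    "\<And>y::real. \<bar>y\<bar> < r \<Longrightarrow> norm (g (\<i> * of_real y)) \<le> 1 + B * \<bar>y\<bar> ^ (2 * p + 2)"
proof -
  define G where "G = fps_expansion g 0"
  have G: "g has_fps_expansion G"
    unfolding G_def by (rule analytic_at_imp_has_fps_expansion_0) fact
  define n where "n = 2 * p + 1"
  have coeff: "fps_nth G k = 1 / fact k" if "k \<le> 2 * p" for k
  proof -
    define T where "T = (\<Sum>l\<le>2 * p. fps_X ^ l * fps_const (1 / fact l :: complex))"
    have "(\<lambda>z. \<Sum>l\<le>2 * p. z ^ l * (1 / fact l)) has_fps_expansion T"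
      unfolding T_def by (intro fps_expansion_intros)
    then have "(\<lambda>z. g z - (\<Sum>l\<le>2 * p. z ^ l / fact l)) has_fps_expansion (G - T)"
      using G by (intro has_fps_expansion_diff) auto
    then have "fps_nth (G - T) k = 0"
      using order that unfolding has_order_def by (rule has_fps_expansion_smallo_imp_nth_eq_0)
    moreover have "fps_nth T k = 1 / fact k"
      using that by (simp add: T_def fps_sum_nth if_distrib[of "\<lambda>x. x / _"] cong: if_cong)
    ultimately show ?thesis by simp
  qed
  \<comment> \<open>Realness of the first coefficient error \<open>e\<close> is what makes its term
    imaginary on the imaginary axis.\<close>
  have "(fact n :: complex) \<in> \<real>"
    by (metis Reals_of_nat of_nat_fact)
  then have "fps_nth G n - 1 / fact n \<in> \<real>"
    using real[of n] by (auto simp: fps_nth_fps_expansion[OF G] intro!: Reals_diff Reals_divide)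
  then obtain e :: real where e: "fps_nth G n - 1 / fact n = of_real e"
    by (auto elim: Reals_cases)
  \<comment> \<open>The comparison is with the full \<open>exp\<close>, whose modulus on the
    imaginary axis is exactly 1. Coefficients below \<open>n\<close> cancel by the order condition,
    the one at \<open>n\<close> by the choice of \<open>e\<close>.\<close>
  have "(\<lambda>z. g z - exp z - of_real e * z ^ n)
      has_fps_expansion (G - fps_exp 1 - fps_const (of_real e) * fps_X ^ n)"
    by (intro fps_expansion_intros G)
  moreover have "fps_nth (G - fps_exp 1 - fps_const (of_real e) * fps_X ^ n) k = 0"
    if "k < Suc n" for k
    using that coeff[of k] e[unfolded n_def] by (cases "k = n") (auto simp: n_def simp del: fact_Suc)
  ultimately have "(\<lambda>z. g z - exp z - of_real e * z ^ n) \<in> O[nhds 0](\<lambda>z. z ^ Suc n)"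
    by (rule has_fps_expansion_imp_bigo)
  then obtain L where L: "L > 0"
    "eventually (\<lambda>z. norm (g z - exp z - of_real e * z ^ n) \<le> L * norm (z ^ Suc n)) (nhds 0)"
    by (elim landau_o.bigE)
  then obtain r0 where r0: "r0 > 0"
    "\<And>z. norm z < r0 \<Longrightarrow> norm (g z - exp z - of_real e * z ^ n) \<le> L * norm (z ^ Suc n)"
    by (auto simp: eventually_nhds_metric)
  show ?thesis
  proof
    \<comment> \<open>\<open>L\<close> pays for the remainder, the bracket for the term of degree
      \<open>n\<close>; the cap 1 on the radius is what the estimate of that term requires.\<close>
    show "L + (\<bar>e\<bar> + e\<^sup>2) > 0" "min r0 1 > 0"
      using L r0 by (auto intro!: add_pos_nonneg)
    fix y :: real
    assume y: "\<bar>y\<bar> < min r0 1"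
    let ?z = "\<i> * of_real y"
    have "norm (g ?z) \<le> norm (exp ?z + of_real e * ?z ^ n)
        + norm (g ?z - exp ?z - of_real e * ?z ^ n)"
      by (rule order_trans[OF _ norm_triangle_ineq]) simp
    also have "\<dots> \<le> (1 + (\<bar>e\<bar> + e\<^sup>2) * \<bar>y\<bar> ^ Suc n) + L * norm (?z ^ Suc n)"
      using y by (intro add_mono norm_exp_ii_add_odd_power_le r0) (auto simp: n_def norm_mult)
    also have "norm (?z ^ Suc n) = \<bar>y\<bar> ^ Suc n"
      by (simp add: norm_power norm_mult del: power_Suc)
    finally show "norm (g ?z) \<le> 1 + (L + (\<bar>e\<bar> + e\<^sup>2)) * \<bar>y\<bar> ^ (2 * p + 2)"
      by (simp add: n_def algebra_simps)
  qed
qed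

text \<open>With \<open>q\<close> for \<delta>x/|a| and \<open>\<tau>\<close> for \<delta>t, the
  quotient \<open>\<tau> / q\<close> is the largest resolved |y|. Raising the CFL condition to the
  power 2p + 1 clears the denominator of the exponent, and one more factor \<open>\<tau>\<close>
  gives the first bound. The second bound makes \<open>\<tau> / q\<close> small with
  \<open>q\<close>, since the exponent exceeds 1 by 1/(2p + 1).\<close>

lemma cfl_power_le:
  fixes C q \<tau> :: real
  assumes "C > 0" "q > 0" "\<tau> > 0"
    and cfl: "\<tau> \<le> C * q powr ((2 * real p + 2) / (2 * real p + 1))"
  shows "(\<tau> / q) ^ (2 * p + 2) \<le> C ^ (2 * p + 1) * \<tau>"
    and "\<tau> / q \<le> C * q powr (1 / (2 * real p + 1))"
proof -
  define \<alpha> where "\<alpha> = (2 * real p + 2) / (2 * real p + 1)"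
  have "(q powr \<alpha>) ^ (2 * p + 1) = q powr (\<alpha> * real (2 * p + 1))"
    using assms by (subst powr_realpow[symmetric]) (auto simp: powr_powr)
  also have "\<alpha> * real (2 * p + 1) = real (2 * p + 2)"
    by (simp add: \<alpha>_def field_simps)
  finally have pow: "(q powr \<alpha>) ^ (2 * p + 1) = q ^ (2 * p + 2)"
    using assms by (simp only: powr_realpow)
  have "\<tau> ^ (2 * p + 1) \<le> (C * q powr \<alpha>) ^ (2 * p + 1)"
    using assms by (intro power_mono) (auto simp: \<alpha>_def)
  also have "\<dots> = C ^ (2 * p + 1) * q ^ (2 * p + 2)"
    by (simp only: power_mult_distrib pow)
  finally have "\<tau> ^ (2 * p + 1) * \<tau> \<le> C ^ (2 * p + 1) * q ^ (2 * p + 2) * \<tau>"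
    using assms by (intro mult_right_mono) auto
  then show "(\<tau> / q) ^ (2 * p + 2) \<le> C ^ (2 * p + 1) * \<tau>"
    using assms by (simp add: power_divide field_simps)
  have \<alpha>: "\<alpha> = 1 + 1 / (2 * real p + 1)"
    by (simp add: \<alpha>_def field_simps)
  have "q powr \<alpha> = q * q powr (1 / (2 * real p + 1))"
    unfolding \<alpha> using assms by (simp add: powr_add)
  then show "\<tau> / q \<le> C * q powr (1 / (2 * real p + 1))"
    using assms by (simp add: \<alpha>_def field_simps)
qed

theorem theorem3p2:
  fixes M :: "real poly mat" and g :: "complex \<Rightarrow> complex" and s p :: nat
  assumes "M \<in> carrier_mat (Suc s) (Suc s)"
    and "p \<ge> 1"
    and "amplification_factor M g"
    and "has_order g (2 * p)"
  shows "\<forall>K::real. K > 0 \<longrightarrow> (\<exists>C::real. C > 0 \<and>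
    (\<forall>a::real. a \<noteq> 0 \<longrightarrow> (\<exists>h::real. h > 0 \<and>
      (\<forall>\<delta>x \<delta>t :: real. 0 < \<delta>x \<and> \<delta>x < h \<and> 0 < \<delta>t \<and>
        \<delta>t \<le> C * (\<delta>x / \<bar>a\<bar>) powr ((2 * real p + 2) / (2 * real p + 1)) \<longrightarrow>
        (\<forall>\<xi>\<in>{- (1 / \<delta>x)..1 / \<delta>x}.
          norm (g (- \<i> * of_real a * of_real \<xi> * of_real \<delta>t)) \<le> 1 + K * \<delta>t)))))"
proof (intro allI impI)
  fix K :: real
  assume K: "K > 0"
  have g: "g analytic_on {0}" "(deriv ^^ n) g 0 \<in> \<real>" for n
    using assms(3) by (auto simp: amplification_factor_def)
  obtain B r where B: "B > 0" "r > 0"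
    "\<And>y::real. \<bar>y\<bar> < r \<Longrightarrow> norm (g (\<i> * of_real y)) \<le> 1 + B * \<bar>y\<bar> ^ (2 * p + 2)"
    using norm_imaginary_axis_bound[OF g assms(4)] by blast
  \<comment> \<open>Solves B C^(2p+1) = K; \<open>C\<close> is fixed before \<open>a\<close>, so it
    depends only on \<open>K\<close>, \<open>p\<close> and the constant \<open>B\<close> obtained
    from \<open>g\<close>.\<close>
  define C where "C = root (2 * p + 1) (K / B)"
  have "C > 0"
    using K B by (simp add: C_def)
  moreover have "C ^ (2 * p + 1) = K / B"
    unfolding C_def using K B by (intro real_root_pow_pos2) auto
  ultimately have C: "C > 0" "B * C ^ (2 * p + 1) = K"
    using B by simp_all
  show "\<exists>C::real. C > 0 \<and>
    (\<forall>a::real. a \<noteq> 0 \<longrightarrow> (\<exists>h::real. h > 0 \<and>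
      (\<forall>\<delta>x \<delta>t :: real. 0 < \<delta>x \<and> \<delta>x < h \<and> 0 < \<delta>t \<and>
        \<delta>t \<le> C * (\<delta>x / \<bar>a\<bar>) powr ((2 * real p + 2) / (2 * real p + 1)) \<longrightarrow>
        (\<forall>\<xi>\<in>{- (1 / \<delta>x)..1 / \<delta>x}.
          norm (g (- \<i> * of_real a * of_real \<xi> * of_real \<delta>t)) \<le> 1 + K * \<delta>t))))"
  proof (rule exI[of _ C], intro conjI allI impI)
    show "C > 0" by fact
    fix a :: real
    assume a: "a \<noteq> 0"
    \<comment> \<open>Solves C (h/|a|)^(1/(2p+1)) = r, so \<delta>x < h keeps |y| inside the radius
      \<open>r\<close>.\<close>
    define h where "h = \<bar>a\<bar> * (r / C) powr (2 * real p + 1)"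
    show "\<exists>h::real. h > 0 \<and>
      (\<forall>\<delta>x \<delta>t :: real. 0 < \<delta>x \<and> \<delta>x < h \<and> 0 < \<delta>t \<and>
        \<delta>t \<le> C * (\<delta>x / \<bar>a\<bar>) powr ((2 * real p + 2) / (2 * real p + 1)) \<longrightarrow>
        (\<forall>\<xi>\<in>{- (1 / \<delta>x)..1 / \<delta>x}.
          norm (g (- \<i> * of_real a * of_real \<xi> * of_real \<delta>t)) \<le> 1 + K * \<delta>t))"
    proof (rule exI[of _ h], intro conjI allI impI ballI; (elim conjE)?)
      show "h > 0"
        using a B C by (simp add: h_def)
      fix \<delta>x \<delta>t \<xi> :: real
      assume x: "0 < \<delta>x" "\<delta>x < h" and t: "0 < \<delta>t"
        and cfl: "\<delta>t \<le> C * (\<delta>x / \<bar>a\<bar>) powr ((2 * real p + 2) / (2 * real p + 1))"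
        and \<xi>: "\<xi> \<in> {- (1 / \<delta>x)..1 / \<delta>x}"
      define q where "q = \<delta>x / \<bar>a\<bar>"
      \<comment> \<open>The argument of \<open>g\<close> is then \<i> y, and |\<xi>| \<le>
        1/\<delta>x becomes |y| \<le> \<delta>t/q.\<close>
      define y where "y = - (a * \<xi> * \<delta>t)"
      have q: "q > 0"
        using a x by (simp add: q_def)
      have "\<bar>y\<bar> = \<bar>a\<bar> * \<bar>\<xi>\<bar> * \<delta>t"
        using t by (simp add: y_def abs_mult)
      also have "\<dots> \<le> \<bar>a\<bar> * (1 / \<delta>x) * \<delta>t"
        using \<xi> t by (intro mult_right_mono mult_left_mono) auto
      also have "\<dots> = \<delta>t / q"
        by (simp add: q_def)
      finally have y: "\<bar>y\<bar> \<le> \<delta>t / q" .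
      have bounds: "(\<delta>t / q) ^ (2 * p + 2) \<le> C ^ (2 * p + 1) * \<delta>t"
        "\<delta>t / q \<le> C * q powr (1 / (2 * real p + 1))"
        using cfl_power_le[OF C(1) q t] cfl by (auto simp: q_def)
      have "q < (r / C) powr (2 * real p + 1)"
        using x a by (simp add: q_def h_def field_simps)
      then have "q powr (1 / (2 * real p + 1))
          < ((r / C) powr (2 * real p + 1)) powr (1 / (2 * real p + 1))"
        using q by (intro powr_less_mono2) auto
      also have "\<dots> = r / C"
        using B C by (simp add: powr_powr)
      finally have "C * q powr (1 / (2 * real p + 1)) < r"
        using C by (simp add: field_simps)
      with y bounds have "\<bar>y\<bar> < r" by linarith
      then have "norm (g (\<i> * of_real y)) \<le> 1 + B * \<bar>y\<bar> ^ (2 * p + 2)"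
        by (rule B)
      also have "\<bar>y\<bar> ^ (2 * p + 2) \<le> C ^ (2 * p + 1) * \<delta>t"
        using power_mono[OF y, of "2 * p + 2"] bounds(1) by simp
      also have "B * (C ^ (2 * p + 1) * \<delta>t) = K * \<delta>t"
        using C by (simp only: mult.assoc[symmetric])
      finally show "norm (g (- \<i> * of_real a * of_real \<xi> * of_real \<delta>t)) \<le> 1 + K * \<delta>t"
        using B by (simp add: y_def mult_ac)
    qed
  qed
qed

end
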